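(* Let $m\ge 2$, $n\ge 1$ and $\mathcal{A}\in T_{m,n}$. Then the following conditions are equivalent: (1) $\mathcal{A}$ is a doubly $B$-tensor. (2) $\mathcal{A}=\mathcal{B}+\mathcal{C}$ for some $\mathcal{B},\mathcal{C}\in T_{m,n}$, where $\mathcal{B}$ is both a $Z$-tensor and a doubly $B$-tensor, and $\mathcal{C}=(c_{i_1\cdots i_m})$ is a nonnegative doubly $B$-tensor of the form $$c_{ii_2\cdots i_m}=\begin{cases} c_i+\epsilon & \text{if }(i_2,\dots,i_m)=(i,\dots,i),\\ c_i & \text{otherwise,}\end{cases}$$ with real numbers $c_i\ge 0$ for $i\in[n]$ and $\epsilon>0$.
   Context: $[n]=\{1,\dots,n\}$. $T_{m,n}$ is the set of real $m$th order $n$-dimensional tensors $\mathcal{A}=(a_{i_1\cdots i_m})$, $i_1,\dots,i_m\in[n]$; addition is entrywise; a tensor is nonnegative if all its entries are nonnegative. For $\mathcal{A}\in T_{m,n}$ and $i\in[n]$ let $r_i^+=\max\{0,\,a_{ij_2\cdots j_m}:(j_2,\dots,j_m)\ne(i,\dots,i)\}$. $\mathcal{A}$ is a doubly $B$-tensor if (1) $a_{i\cdots i}>r_i^+$ for all $i\in[n]$, and (2) for all $i\ne j$ in $[n]$, $$(a_{i\cdots i}-r_i^+)(a_{j\cdots j}-r_j^+)>\sum_{(i_2,\dots,i_m)\ne(i,\dots,i)}(r_i^+-a_{ii_2\cdots i_m})\sum_{(j_2,\dots,j_m)\ne(j,\dots,j)}(r_j^+-a_{jj_2\cdots j_m}).$$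 $\mathcal{A}$ is a $Z$-tensor if all its off-diagonal entries are non-positive, i.e. $a_{ii_2\cdots i_m}\le 0$ for all $i\in[n]$ and $(i_2,\dots,i_m)\neq(i,\dots,i)$. *)

theory Defs
  imports Complex_Main "HOL-Library.FuncSet"
begin

definition multi_indices :: "nat \<Rightarrow> nat \<Rightarrow> nat list set" where
  "multi_indices k n = {xs. length xs = k \<and> set xs \<subseteq> {1..n}}"

lemma finite_multi_indices: "finite (multi_indices k n)"
  using finite_lists_length_eq[of "{1..n}" k]
  by (simp add: multi_indices_def conj_commute)

text \<open>A tensor is a real function on the m-tuples over [n], made extensional so that equality
  of tensors is equality of all entries; the entry with indices i, i2, ..., im is
  \<open>A [i, i2, ..., im]\<close>.\<close>

definition tensors :: "nat \<Rightarrow> nat \<Rightarrow> (nat list \<Rightarrow> real) set" where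
  "tensors m n = multi_indices m n \<rightarrow>\<^sub>E UNIV"

definition tensor_add ::
  "nat \<Rightarrow> nat \<Rightarrow> (nat list \<Rightarrow> real) \<Rightarrow> (nat list \<Rightarrow> real) \<Rightarrow> nat list \<Rightarrow> real" where
  "tensor_add m n A B = (\<lambda>xs\<in>multi_indices m n. A xs + B xs)"

definition nonneg_tensor :: "nat \<Rightarrow> nat \<Rightarrow> (nat list \<Rightarrow> real) \<Rightarrow> bool" where
  "nonneg_tensor m n A \<longleftrightarrow> (\<forall>xs\<in>multi_indices m n. A xs \<ge> 0)"

text \<open>The tuples (i2, ..., im) different from (i, ..., i).\<close>

definition off_diag :: "nat \<Rightarrow> nat \<Rightarrow> nat \<Rightarrow> nat list set" where
  "off_diag m n i = multi_indices (m - 1) n - {replicate (m - 1) i}"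

definition r_plus :: "nat \<Rightarrow> nat \<Rightarrow> (nat list \<Rightarrow> real) \<Rightarrow> nat \<Rightarrow> real" where
  "r_plus m n A i = Max (insert 0 ((\<lambda>js. A (i # js)) ` off_diag m n i))"

definition doubly_B_tensor :: "nat \<Rightarrow> nat \<Rightarrow> (nat list \<Rightarrow> real) \<Rightarrow> bool" where
  "doubly_B_tensor m n A \<longleftrightarrow>
     (\<forall>i\<in>{1..n}. A (replicate m i) > r_plus m n A i) \<and>
     (\<forall>i\<in>{1..n}. \<forall>j\<in>{1..n}. i \<noteq> j \<longrightarrow>
        (A (replicate m i) - r_plus m n A i) * (A (replicate m j) - r_plus m n A j) >
        (\<Sum>js\<in>off_diag m n i. r_plus m n A i - A (i # js)) *
        (\<Sum>js\<in>off_diag m n j. r_plus m n A j - A (j # js)))"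

definition Z_tensor :: "nat \<Rightarrow> nat \<Rightarrow> (nat list \<Rightarrow> real) \<Rightarrow> bool" where
  "Z_tensor m n A \<longleftrightarrow> (\<forall>i\<in>{1..n}. \<forall>js\<in>off_diag m n i. A (i # js) \<le> 0)"

end

theory Submission
  imports Defs
begin

text \<open>
  Forward: take \<open>c i = r_plus m n A i\<close>. Subtracting \<open>c i\<close> from row \<open>i\<close> turns the doubly
  B inequalities of \<open>A\<close> into those of a Z-tensor, and since finitely many strict inequalities
  are involved, the diagonal can be lowered by a further small \<open>\<epsilon>\<close>.
  Backward: in row \<open>i\<close> the off-diagonal entries of \<open>A\<close> are at most \<open>c i\<close>, so
  \<open>r_plus m n A i \<le> c i\<close>. Hence passing from \<open>B\<close> to \<open>A\<close> can only increase the
  diagonal gaps and decrease the (nonnegative) off-diagonal deficiency sums.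
\<close>

lemma finite_off_diag: "finite (off_diag m n i)"
  by (simp add: off_diag_def finite_multi_indices)

lemma Cons_in_multi_indices:
  assumes "m \<ge> 1" "i \<in> {1..n}" "js \<in> multi_indices (m - 1) n"
  shows "i # js \<in> multi_indices m n"
  using assms by (auto simp: multi_indices_def)

lemma replicate_in_multi_indices: "i \<in> {1..n} \<Longrightarrow> replicate k i \<in> multi_indices k n"
  by (auto simp: multi_indices_def)

text \<open>Bridges the two notations for entries: diagonal ones are addressed by
  \<open>replicate m i\<close>, whereas row formulas use \<open>i # js\<close>.\<close>

lemma replicate_eq_Cons_pred: "m \<ge> 1 \<Longrightarrow> replicate m i = i # replicate (m - 1) i"
  by (cases m) auto

lemma r_plus_nonneg: "r_plus m n A i \<ge> 0"
  unfolding r_plus_def by (rule Max_ge) (auto simp: finite_off_diag)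

lemma r_plus_ge: "js \<in> off_diag m n i \<Longrightarrow> A (i # js) \<le> r_plus m n A i"
  unfolding r_plus_def by (rule Max_ge) (auto simp: finite_off_diag)

lemma r_plus_le:
  assumes "c \<ge> 0" "\<And>js. js \<in> off_diag m n i \<Longrightarrow> A (i # js) \<le> c"
  shows "r_plus m n A i \<le> c"
  unfolding r_plus_def using assms by (subst Max_le_iff) (auto simp: finite_off_diag)

lemma r_plus_Z_tensor:
  assumes "Z_tensor m n A" "i \<in> {1..n}"
  shows "r_plus m n A i = 0"
  using assms by (intro antisym r_plus_le r_plus_nonneg) (auto simp: Z_tensor_def)

text \<open>Serves the summand \<open>C\<close>. When a row is constant off the diagonal, its
  deficiency sum vanishes, so the product condition reduces to positivity of the gaps.\<close>

lemma doubly_B_tensorI_constant_rows: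
  assumes c: "\<And>i. i \<in> {1..n} \<Longrightarrow> c i \<ge> 0"
    and diag: "\<And>i. i \<in> {1..n} \<Longrightarrow> A (replicate m i) > c i"
    and off: "\<And>i js. i \<in> {1..n} \<Longrightarrow> js \<in> off_diag m n i \<Longrightarrow> A (i # js) = c i"
  shows "doubly_B_tensor m n A"
proof -
  \<comment> \<open>Only an upper bound on \<open>r_plus\<close> is used here: if
    \<open>off_diag m n i\<close> is empty, \<open>r_plus\<close> is 0 and may lie strictly below
    \<open>c i\<close>.\<close>
  have r: "r_plus m n A i < A (replicate m i)" if "i \<in> {1..n}" for i
    using r_plus_le[of "c i" m n i A] c diag off that by force
  have s: "(\<Sum>js\<in>off_diag m n i. r_plus m n A i - A (i # js)) = 0" if i: "i \<in> {1..n}" for i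
  proof (rule sum.neutral, rule ballI)
    fix js assume "js \<in> off_diag m n i"
    \<comment> \<open>The given \<open>js\<close> witnesses that \<open>c i\<close> occurs as an
      entry, which forces \<open>r_plus m n A i = c i\<close>.\<close>
    then show "r_plus m n A i - A (i # js) = 0"
      using r_plus_le[of "c i" m n i A] r_plus_ge[of js m n i A] c off i by force
  qed
  show ?thesis
    using r s by (simp add: doubly_B_tensor_def)
qed

text \<open>The product condition can be compared factor by factor, because the gaps of
  \<open>B\<close> are positive and the deficiency sums of \<open>A\<close> are nonnegative.\<close>

lemma doubly_B_tensor_mono:
  assumes B: "doubly_B_tensor m n B"
    and gap: "\<And>i. i \<in> {1..n} \<Longrightarrow>
      B (replicate m i) - r_plus m n B i \<le> A (replicate m i) - r_plus m n A i"
    and off: "\<And>i js. i \<in> {1..n} \<Longrightarrow> js \<in> off_diag m n i \<Longrightarrow>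
      r_plus m n A i - A (i # js) \<le> r_plus m n B i - B (i # js)"
  shows "doubly_B_tensor m n A"
proof -
  define g where "g X i = X (replicate m i) - r_plus m n X i" for X i
  define S where "S X i = (\<Sum>js\<in>off_diag m n i. r_plus m n X i - X (i # js))" for X i
  have gB: "g B i > 0" if "i \<in> {1..n}" for i
    using B that by (auto simp: doubly_B_tensor_def g_def)
  have gap': "g B i \<le> g A i" if "i \<in> {1..n}" for i
    using gap that by (simp add: g_def)
  have SA: "S A i \<ge> 0" for i
    unfolding S_def by (rule sum_nonneg) (simp add: r_plus_ge)
  have SAB: "S A i \<le> S B i" if "i \<in> {1..n}" for i
    unfolding S_def using off that by (intro sum_mono)
  have "S A i * S A j < g A i * g A j" if ij: "i \<in> {1..n}" "j \<in> {1..n}" "i \<noteq> j" for i j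
  proof -
    have "S A i * S A j \<le> S B i * S B j"
      using SA SAB ij order_trans[OF SA SAB] by (intro mult_mono) auto
    also have "\<dots> < g B i * g B j"
      using B ij by (auto simp: doubly_B_tensor_def g_def S_def)
    also have "\<dots> \<le> g A i * g A j"
      using gap' gB ij order_trans[OF less_imp_le[OF gB] gap']
      by (intro mult_mono less_imp_le[OF gB]) auto
    finally show ?thesis .
  qed
  moreover have "g A i > 0" if "i \<in> {1..n}" for i
    using gB gap' that by force
  ultimately show ?thesis
    by (auto simp: doubly_B_tensor_def g_def S_def)
qed

text \<open>Each strict inequality holds at \<epsilon> = 0 and is continuous in \<epsilon>, so it
  persists for small positive \<epsilon>. As there are only finitely many, one \<epsilon> serves
  them all.\<close>

lemma doubly_B_tensor_slack:
  assumes A: "doubly_B_tensor m n A"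
  obtains \<epsilon> :: real where "\<epsilon> > 0"
    "\<And>i. i \<in> {1..n} \<Longrightarrow> A (replicate m i) - r_plus m n A i - \<epsilon> > 0"
    "\<And>i j. i \<in> {1..n} \<Longrightarrow> j \<in> {1..n} \<Longrightarrow> i \<noteq> j \<Longrightarrow>
      (A (replicate m i) - r_plus m n A i - \<epsilon>) * (A (replicate m j) - r_plus m n A j - \<epsilon>) >
      (\<Sum>js\<in>off_diag m n i. r_plus m n A i - A (i # js)) *
      (\<Sum>js\<in>off_diag m n j. r_plus m n A j - A (j # js))"
proof -
  define g where "g i = A (replicate m i) - r_plus m n A i" for i
  define S where "S i = (\<Sum>js\<in>off_diag m n i. r_plus m n A i - A (i # js))" for i
  have lim: "((\<lambda>e. g i - e) \<longlongrightarrow> g i) (at_right 0)" for i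
    by (rule tendsto_eq_intros refl | simp)+
  have "eventually (\<lambda>e. g i - e > 0) (at_right 0)" if "i \<in> {1..n}" for i
  proof -
    have "g i > 0"
      using A that by (simp add: doubly_B_tensor_def g_def)
    from order_tendstoD(1)[OF lim this] show ?thesis .
  qed
  then have 1: "eventually (\<lambda>e. \<forall>i\<in>{1..n}. g i - e > 0) (at_right 0)"
    by (intro eventually_ball_finite) auto
  have "eventually (\<lambda>e. i \<noteq> j \<longrightarrow> (g i - e) * (g j - e) > S i * S j) (at_right 0)"
    if "i \<in> {1..n}" "j \<in> {1..n}" for i j
  proof (cases "i = j")
    case False
    then have "S i * S j < g i * g j"
      using A that by (auto simp: doubly_B_tensor_def g_def S_def)
    from order_tendstoD(1)[OF tendsto_mult[OF lim lim] this] show ?thesis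
      by (rule eventually_mono) simp
  qed simp
  then have 2: "eventually (\<lambda>e. \<forall>i\<in>{1..n}. \<forall>j\<in>{1..n}. i \<noteq> j \<longrightarrow>
      (g i - e) * (g j - e) > S i * S j) (at_right 0)"
    by (intro eventually_ball_finite ballI) auto
  have "eventually (\<lambda>e::real. e > 0) (at_right 0)"
    by (rule eventually_at_right_less)
  with 1 2 have "eventually (\<lambda>e. e > 0 \<and> (\<forall>i\<in>{1..n}. g i - e > 0) \<and>
      (\<forall>i\<in>{1..n}. \<forall>j\<in>{1..n}. i \<noteq> j \<longrightarrow> (g i - e) * (g j - e) > S i * S j)) (at_right 0)"
    by eventually_elim auto
  \<comment> \<open>The filter \<open>at_right 0\<close> on the reals is nontrivial, so a property
    that holds eventually has a witness.\<close>
  then obtain e where "e > 0" "\<forall>i\<in>{1..n}. g i - e > 0"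
    "\<forall>i\<in>{1..n}. \<forall>j\<in>{1..n}. i \<noteq> j \<longrightarrow> (g i - e) * (g j - e) > S i * S j"
    using eventually_happens'[OF trivial_limit_at_right_real] by blast
  then show thesis
    by (intro that[of e]) (auto simp: g_def S_def)
qed

theorem theorem4:
  fixes m n :: nat and A :: "nat list \<Rightarrow> real"
  assumes "m \<ge> 2" and "n \<ge> 1" and "A \<in> tensors m n"
  shows "doubly_B_tensor m n A \<longleftrightarrow>
    (\<exists>B\<in>tensors m n. \<exists>C\<in>tensors m n.
       A = tensor_add m n B C \<and>
       Z_tensor m n B \<and> doubly_B_tensor m n B \<and>
       nonneg_tensor m n C \<and> doubly_B_tensor m n C \<and>
       (\<exists>(c :: nat \<Rightarrow> real) (\<epsilon> :: real).
          (\<forall>i\<in>{1..n}. c i \<ge> 0) \<and> \<epsilon> > 0 \<and>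
          (\<forall>i\<in>{1..n}. \<forall>js\<in>multi_indices (m - 1) n.
             C (i # js) = (if js = replicate (m - 1) i then c i + \<epsilon> else c i))))"
proof -
  have diag: "replicate m i = i # replicate (m - 1) i" for i
    using \<open>m \<ge> 2\<close> by (simp add: replicate_eq_Cons_pred)
  have mem: "i # js \<in> multi_indices m n" if "i \<in> {1..n}" "js \<in> multi_indices (m - 1) n" for i js
    using that \<open>m \<ge> 2\<close> by (intro Cons_in_multi_indices) auto
  have diag_mem: "replicate m i \<in> multi_indices m n" if "i \<in> {1..n}" for i
    using that by (rule replicate_in_multi_indices)
  have off_mem: "i # js \<in> multi_indices m n" if "i \<in> {1..n}" "js \<in> off_diag m n i" for i js
    using that mem by (auto simp: off_diag_def)
  show ?thesis
  proof
    assume dA: "doubly_B_tensor m n A"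
    obtain \<epsilon> :: real where \<epsilon>: "\<epsilon> > 0"
      and gap: "\<And>i. i \<in> {1..n} \<Longrightarrow> A (replicate m i) - r_plus m n A i - \<epsilon> > 0"
      and gap2: "\<And>i j. i \<in> {1..n} \<Longrightarrow> j \<in> {1..n} \<Longrightarrow> i \<noteq> j \<Longrightarrow>
        (A (replicate m i) - r_plus m n A i - \<epsilon>) * (A (replicate m j) - r_plus m n A j - \<epsilon>) >
        (\<Sum>js\<in>off_diag m n i. r_plus m n A i - A (i # js)) *
        (\<Sum>js\<in>off_diag m n j. r_plus m n A j - A (j # js))"
      using doubly_B_tensor_slack[OF dA] by blast
    define c where "c = r_plus m n A"
    \<comment> \<open>The row index of a tuple is its head, so a tuple is diagonal exactly when it
      repeats its head \<open>m\<close> times.\<close>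
    define C where "C = (\<lambda>xs\<in>multi_indices m n.
      if xs = replicate m (hd xs) then c (hd xs) + \<epsilon> else c (hd xs))"
    define B where "B = (\<lambda>xs\<in>multi_indices m n. A xs - C xs)"
    have c0: "c i \<ge> 0" for i
      by (simp add: c_def r_plus_nonneg)
    have tens: "B \<in> tensors m n" "C \<in> tensors m n"
      by (auto simp: B_def C_def tensors_def)
    have sum: "A = tensor_add m n B C"
    proof
      \<comment> \<open>Outside \<open>multi_indices m n\<close> both sides are
        \<open>undefined\<close>, since tensors are extensional.\<close>
      fix xs show "A xs = tensor_add m n B C xs"
        using \<open>A \<in> tensors m n\<close>
        by (cases "xs \<in> multi_indices m n") (auto simp: tensor_add_def B_def tensors_def)
    qed
    have Centry: "C (i # js) = (if js = replicate (m - 1) i then c i + \<epsilon> else c i)"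
      if "i \<in> {1..n}" "js \<in> multi_indices (m - 1) n" for i js
      using mem[OF that] by (simp add: C_def diag[of i])
    have Cdiag: "C (replicate m i) = c i + \<epsilon>" if "i \<in> {1..n}" for i
      using that by (simp add: diag Centry replicate_in_multi_indices)
    have Coff: "C (i # js) = c i" if "i \<in> {1..n}" "js \<in> off_diag m n i" for i js
      using that Centry by (auto simp: off_diag_def)
    have Bdiag: "B (replicate m i) = A (replicate m i) - c i - \<epsilon>" if "i \<in> {1..n}" for i
      using that diag_mem Cdiag by (simp add: B_def)
    have Boff: "B (i # js) = A (i # js) - c i" if "i \<in> {1..n}" "js \<in> off_diag m n i" for i js
      using that off_mem Coff by (simp add: B_def)
    have ZB: "Z_tensor m n B"
      unfolding Z_tensor_def using Boff r_plus_ge by (auto simp: c_def)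
    \<comment> \<open>Since \<open>r_plus\<close> vanishes for the Z-tensor \<open>B\<close>, the
      left side is its deficiency sum. The sums of \<open>A\<close> are thus unchanged while each
      gap drops by \<epsilon>, which is the situation of \<open>gap\<close> and
      \<open>gap2\<close>.\<close>
    have SB: "(\<Sum>js\<in>off_diag m n i. - B (i # js)) =
        (\<Sum>js\<in>off_diag m n i. r_plus m n A i - A (i # js))" if "i \<in> {1..n}" for i
      using that by (intro sum.cong) (auto simp: Boff c_def)
    have dB: "doubly_B_tensor m n B"
      unfolding doubly_B_tensor_def
      using gap gap2 by (simp add: r_plus_Z_tensor[OF ZB] Bdiag SB c_def)
    have dC: "doubly_B_tensor m n C"
      using c0 \<epsilon> Cdiag Coff by (intro doubly_B_tensorI_constant_rows[of n c]) auto
    have nC: "nonneg_tensor m n C"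
      using c0 \<epsilon> by (auto simp: nonneg_tensor_def C_def intro: add_nonneg_nonneg)
    show "\<exists>B\<in>tensors m n. \<exists>C\<in>tensors m n.
       A = tensor_add m n B C \<and>
       Z_tensor m n B \<and> doubly_B_tensor m n B \<and>
       nonneg_tensor m n C \<and> doubly_B_tensor m n C \<and>
       (\<exists>(c :: nat \<Rightarrow> real) (\<epsilon> :: real).
          (\<forall>i\<in>{1..n}. c i \<ge> 0) \<and> \<epsilon> > 0 \<and>
          (\<forall>i\<in>{1..n}. \<forall>js\<in>multi_indices (m - 1) n.
             C (i # js) = (if js = replicate (m - 1) i then c i + \<epsilon> else c i)))"
      using tens sum ZB dB nC dC c0 \<epsilon> Centry by blast
  next
    assume "\<exists>B\<in>tensors m n. \<exists>C\<in>tensors m n.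
       A = tensor_add m n B C \<and>
       Z_tensor m n B \<and> doubly_B_tensor m n B \<and>
       nonneg_tensor m n C \<and> doubly_B_tensor m n C \<and>
       (\<exists>(c :: nat \<Rightarrow> real) (\<epsilon> :: real).
          (\<forall>i\<in>{1..n}. c i \<ge> 0) \<and> \<epsilon> > 0 \<and>
          (\<forall>i\<in>{1..n}. \<forall>js\<in>multi_indices (m - 1) n.
             C (i # js) = (if js = replicate (m - 1) i then c i + \<epsilon> else c i)))"
    then obtain B C c \<epsilon> where sum: "A = tensor_add m n B C"
      and ZB: "Z_tensor m n B" and dB: "doubly_B_tensor m n B"
      and c0: "\<forall>i\<in>{1..n}. c i \<ge> (0::real)" and \<epsilon>: "\<epsilon> > (0::real)"
      and Centry: "\<forall>i\<in>{1..n}. \<forall>js\<in>multi_indices (m - 1) n.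
             C (i # js) = (if js = replicate (m - 1) i then c i + \<epsilon> else c i)"
      by blast
    have Adiag: "A (replicate m i) = B (replicate m i) + c i + \<epsilon>" if "i \<in> {1..n}" for i
      using that diag_mem[OF that] Centry
      by (simp add: sum tensor_add_def diag replicate_in_multi_indices)
    have Aoff: "A (i # js) = B (i # js) + c i" if "i \<in> {1..n}" "js \<in> off_diag m n i" for i js
      using that off_mem[OF that] Centry by (auto simp: sum tensor_add_def off_diag_def)
    \<comment> \<open>The bound holds because the off-diagonal entries of \<open>B\<close> are
      nonpositive; \<open>c0\<close> covers the 0 included in the maximum. Equality may
      fail.\<close>
    have r: "r_plus m n A i \<le> c i" if "i \<in> {1..n}" for i
      using that c0 Aoff ZB by (intro r_plus_le) (auto simp: Z_tensor_def)
    show "doubly_B_tensor m n A"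
    proof (rule doubly_B_tensor_mono[OF dB])
      fix i assume i: "i \<in> {1..n}"
      \<comment> \<open>With \<open>r_plus m n B i = 0\<close>, the gap grows by
        \<open>c i + \<epsilon> - r_plus m n A i\<close>, which is at least \<epsilon>.\<close>
      show "B (replicate m i) - r_plus m n B i \<le> A (replicate m i) - r_plus m n A i"
        using r[OF i] \<epsilon> by (simp add: r_plus_Z_tensor[OF ZB i] Adiag[OF i])
      \<comment> \<open>Each deficiency changes by \<open>r_plus m n A i - c i\<close>, which is
        nonpositive.\<close>
      show "r_plus m n A i - A (i # js) \<le> r_plus m n B i - B (i # js)"
        if "js \<in> off_diag m n i" for js
        using r[OF i] by (simp add: r_plus_Z_tensor[OF ZB i] Aoff[OF i that])
    qed
  qed
qed

end
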